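(* Let $(\mathbf X,\mathbf Y,\mathbf Z)$ be a 1-Markov process as described in the context, with causally sufficient conditioning sets $\mathcal C_t^{-\mathbf X}$. (i) If $\mathbf X\overset{\mathrm{tail}}{\longrightarrow}\mathbf Y$, then $\mathbf X\overset{G}{\to}\mathbf Y$ (that is, $\mathbf X$ Granger-causes $\mathbf Y$). (ii) Suppose in addition that $\mathbf Y$ is structurally generated, $Y_t=h_Y(X_{t-1},Y_{t-1},\mathbf Z_{t-1},\varepsilon^Y_t)$ for all $t\in\mathbb Z$, as described in the context, and that either $\lim_{x\to\infty}h_Y(x,y,\mathbf z,e)=\infty$ for all admissible values of $(y,\mathbf z,e)$, or $h_Y$ is constant in $x$. If $\mathbf X\overset{G}{\to}\mathbf Y$, then $\mathbf X\overset{\mathrm{tail}}{\longrightarrow}\mathbf Y$.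
   Context: Setting. $\mathbf W=(\mathbf X,\mathbf Y,\mathbf Z)=((X_t,Y_t,\mathbf Z_t)^\top,t\in\mathbb Z)$ is a stochastic process on one probability space with $X_t,Y_t$ real-valued and $\mathbf Z_t$ finite-dimensional. It is 1-Markov: $\sigma(\mathbf W_s:s\ge t+1)$ and $\sigma(\mathbf W_s:s\le t-1)$ are conditionally independent given $\sigma(\mathbf W_t)$, for all $t$. $X_t$ and $Y_t$ are supported on some neighborhood of infinity for every $t$. Write $\mathrm{past}(t)=(t,t-1,t-2,\dots)$ and $\mathcal C_t^{-\mathbf X}=\sigma(\mathbf Y_{\mathrm{past}(t)},\mathbf Z_{\mathrm{past}(t)})$. Coefficients. $F$ is a fixed cumulative distribution function with $F(x)<1$ for all $x\in\mathbb R$. Define $\Gamma^t_{\mathbf X\to\mathbf Y\mid\mathcal C}=\lim_{v\to\infty}\mathbb E[F(Y_{t+1})\mid X_t>v,\mathcal C_t^{-\mathbf X}]$ and $\Gamma^{t,\mathrm{baseline}}_{\mathbf X\to\mathbf Y\mid\mathcal C}=\mathbb E[F(Y_{t+1})\mid\mathcal C_t^{-\mathbf X}]$. Here $\mathbb E[\,\cdot\mid X_t>v,\mathcal G]$ denotes $\mathbb E[\,\cdot\,\mathbf 1\{X_t>v\}\mid\mathcal G]/P(X_t>v\mid\mathcal G)$. The coefficients are assumed well defined (conditional probabilities in the denominators are a.s. positive and the limit exists a.s.). Causal relations. $\mathbf X\overset{\mathrm{tail}}{\longrightarrow}\mathbf Y$ means that for some $t\in\mathbb Z$ the variables $\Gamma^t_{\mathbf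 X\to\mathbf Y\mid\mathcal C}$ and $\Gamma^{t,\mathrm{baseline}}_{\mathbf X\to\mathbf Y\mid\mathcal C}$ are not almost surely equal. $\mathbf X\overset{G}{\to}\mathbf Y$ (Granger causality) means that for some $t\in\mathbb Z$, $Y_{t+1}$ is not conditionally independent of $\mathbf X_{\mathrm{past}(t)}$ given $\mathcal C_t^{-\mathbf X}$. The notation without "$\mid\mathbf Z$" is used under the convention that $\mathcal C_t^{-\mathbf X}$ is causally sufficient: replacing it by any admissible enlargement of the information available up to time $t$ not containing $\mathbf X_{\mathrm{past}(t)}$ does not change whether the relation holds. Structural generation. $(\mathbf X,\mathbf Y,\mathbf Z)$ is (strictly) stationary, $h_Y$ is measurable, and the noise satisfies: $\varepsilon^Y_t$ is independent of $\sigma(X_s,Y_s,\mathbf Z_s:s<t)$ for all $t\in\mathbb Z$. *)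

theory Defs
  imports "HOL-Probability.Probability"
begin

section \<open>Generated sigma-algebras and conditional independence\<close>

definition gen_sigma ::
    "'a measure \<Rightarrow> (int \<Rightarrow> 'a \<Rightarrow> 'b::topological_space) \<Rightarrow> int set \<Rightarrow> 'a measure" where
  "gen_sigma M V S =
     sigma (space M) (\<Union>s\<in>S. sets (vimage_algebra (space M) (V s) borel))"

definition joint ::
    "(int \<Rightarrow> 'a \<Rightarrow> real) \<Rightarrow> (int \<Rightarrow> 'a \<Rightarrow> real) \<Rightarrow> (int \<Rightarrow> 'a \<Rightarrow> 'z)
      \<Rightarrow> int \<Rightarrow> 'a \<Rightarrow> real \<times> real \<times> 'z" where
  "joint X Y Z t \<omega> = (X t \<omega>, Y t \<omega>, Z t \<omega>)"

definition info_without_X ::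
    "'a measure \<Rightarrow> (int \<Rightarrow> 'a \<Rightarrow> real) \<Rightarrow> (int \<Rightarrow> 'a \<Rightarrow> 'z::euclidean_space)
      \<Rightarrow> int \<Rightarrow> 'a measure" where
  "info_without_X M Y Z t = gen_sigma M (\<lambda>s \<omega>. (Y s \<omega>, Z s \<omega>)) {..t}"

definition cond_prob_given :: "'a measure \<Rightarrow> 'a measure \<Rightarrow> 'a set \<Rightarrow> 'a \<Rightarrow> real" where
  "cond_prob_given M G A = real_cond_exp M G (indicator A)"

definition cond_indep :: "'a measure \<Rightarrow> 'a measure \<Rightarrow> 'a measure \<Rightarrow> 'a measure \<Rightarrow> bool" where
  "cond_indep M H K G \<longleftrightarrow>
     (\<forall>A\<in>sets H. \<forall>B\<in>sets K.
        AE \<omega> in M. cond_prob_given M G (A \<inter> B) \<omega>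
                 = cond_prob_given M G A \<omega> * cond_prob_given M G B \<omega>)"

definition one_markov ::
    "'a measure \<Rightarrow> (int \<Rightarrow> 'a \<Rightarrow> 'b::topological_space) \<Rightarrow> bool" where
  "one_markov M W \<longleftrightarrow>
     (\<forall>t. cond_indep M (gen_sigma M W {t+1..}) (gen_sigma M W {..t-1}) (gen_sigma M W {t}))"

definition strictly_stationary ::
    "'a measure \<Rightarrow> (int \<Rightarrow> 'a \<Rightarrow> 'b::topological_space) \<Rightarrow> bool" where
  "strictly_stationary M W \<longleftrightarrow>
     (\<forall>k. distr M (PiM UNIV (\<lambda>_. borel)) (\<lambda>\<omega> t. W (t + k) \<omega>)
        = distr M (PiM UNIV (\<lambda>_. borel)) (\<lambda>\<omega> t. W t \<omega>))"

definition law_support :: "'a measure \<Rightarrow> ('a \<Rightarrow> real) \<Rightarrow> real set" where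
  "law_support M V =
     {x. \<forall>U. open U \<longrightarrow> x \<in> U \<longrightarrow> measure M (V -` U \<inter> space M) > 0}"

definition supported_near_infinity :: "'a measure \<Rightarrow> ('a \<Rightarrow> real) \<Rightarrow> bool" where
  "supported_near_infinity M V \<longleftrightarrow> (\<exists>c. {c<..} \<subseteq> law_support M V)"


section \<open>Tail coefficients and causal relations\<close>

text \<open>
  The relations below take the conditioning information as a family \<open>C\<close> of
  sigma-algebras, so that they can also be evaluated for enlargements of
  \<open>info_without_X\<close>.
\<close>

definition exceedance :: "'a measure \<Rightarrow> ('a \<Rightarrow> real) \<Rightarrow> real \<Rightarrow> 'a set" where
  "exceedance M V v = {\<omega> \<in> space M. V \<omega> > v}"

definition cond_exp_exceed ::
    "'a measure \<Rightarrow> 'a measure \<Rightarrow> ('a \<Rightarrow> real) \<Rightarrow> ('a \<Rightarrow> real) \<Rightarrow> real \<Rightarrow> 'a \<Rightarrow> real" where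
  "cond_exp_exceed M G U V v \<omega> =
     real_cond_exp M G (\<lambda>\<omega>'. U \<omega>' * indicator (exceedance M V v) \<omega>') \<omega>
       / cond_prob_given M G (exceedance M V v) \<omega>"

text \<open>
  For each of the uncountably many \<open>v\<close>, \<open>cond_exp_exceed\<close> is one arbitrary version, determined
  only up to a null set depending on \<open>v\<close>.  The almost sure limit over real \<open>v\<close> is therefore
  understood as a pathwise limit for some choice of versions \<open>R v\<close>.  The limit \<open>\<Gamma>\<close> does not
  depend on this choice, up to almost sure equality, since it is determined by integer \<open>v\<close>.
\<close>

definition is_tail_coeff ::
    "'a measure \<Rightarrow> (real \<Rightarrow> real) \<Rightarrow> (int \<Rightarrow> 'a \<Rightarrow> real) \<Rightarrow> (int \<Rightarrow> 'a \<Rightarrow> real)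
      \<Rightarrow> (int \<Rightarrow> 'a measure) \<Rightarrow> int \<Rightarrow> ('a \<Rightarrow> real) \<Rightarrow> bool" where
  "is_tail_coeff M F X Y C t \<Gamma> \<longleftrightarrow>
     \<Gamma> \<in> borel_measurable (C t) \<and>
     (\<exists>R :: real \<Rightarrow> 'a \<Rightarrow> real.
        (\<forall>v. R v \<in> borel_measurable (C t) \<and>
             (AE \<omega> in M. R v \<omega> = cond_exp_exceed M (C t) (\<lambda>\<omega>'. F (Y (t+1) \<omega>')) (X t) v \<omega>)) \<and>
        (AE \<omega> in M. ((\<lambda>v. R v \<omega>) \<longlongrightarrow> \<Gamma> \<omega>) at_top))"

definition baseline_coeff ::
    "'a measure \<Rightarrow> (real \<Rightarrow> real) \<Rightarrow> (int \<Rightarrow> 'a \<Rightarrow> real)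
      \<Rightarrow> (int \<Rightarrow> 'a measure) \<Rightarrow> int \<Rightarrow> 'a \<Rightarrow> real" where
  "baseline_coeff M F Y C t = real_cond_exp M (C t) (\<lambda>\<omega>. F (Y (t+1) \<omega>))"

definition tail_coeffs_well_defined ::
    "'a measure \<Rightarrow> (real \<Rightarrow> real) \<Rightarrow> (int \<Rightarrow> 'a \<Rightarrow> real) \<Rightarrow> (int \<Rightarrow> 'a \<Rightarrow> real)
      \<Rightarrow> (int \<Rightarrow> 'a measure) \<Rightarrow> bool" where
  "tail_coeffs_well_defined M F X Y C \<longleftrightarrow>
     (\<forall>t. (\<forall>v. AE \<omega> in M. cond_prob_given M (C t) (exceedance M (X t) v) \<omega> > 0) \<and>
          (\<exists>\<Gamma>. is_tail_coeff M F X Y C t \<Gamma>))"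

definition tail_causes ::
    "'a measure \<Rightarrow> (real \<Rightarrow> real) \<Rightarrow> (int \<Rightarrow> 'a \<Rightarrow> real) \<Rightarrow> (int \<Rightarrow> 'a \<Rightarrow> real)
      \<Rightarrow> (int \<Rightarrow> 'a measure) \<Rightarrow> bool" where
  "tail_causes M F X Y C \<longleftrightarrow>
     (\<exists>t \<Gamma>. is_tail_coeff M F X Y C t \<Gamma> \<and>
            \<not> (AE \<omega> in M. \<Gamma> \<omega> = baseline_coeff M F Y C t \<omega>))"

definition granger_causes ::
    "'a measure \<Rightarrow> (int \<Rightarrow> 'a \<Rightarrow> real) \<Rightarrow> (int \<Rightarrow> 'a \<Rightarrow> real)
      \<Rightarrow> (int \<Rightarrow> 'a measure) \<Rightarrow> bool" where
  "granger_causes M X Y C \<longleftrightarrow>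
     (\<exists>t. \<not> cond_indep M (gen_sigma M Y {t+1}) (gen_sigma M X {..t}) (C t))"


section \<open>Causal sufficiency\<close>

text \<open>\<open>I t\<close> is the information available up to time \<open>t\<close>.\<close>

definition information_flow ::
    "'a measure \<Rightarrow> (int \<Rightarrow> 'a \<Rightarrow> 'b::topological_space) \<Rightarrow> (int \<Rightarrow> 'a measure) \<Rightarrow> bool" where
  "information_flow M W I \<longleftrightarrow>
     filtration (space M) I \<and>
     (\<forall>t. subalgebra M (I t) \<and> subalgebra (I t) (gen_sigma M W {..t}))"

definition enlarges ::
    "'a measure \<Rightarrow> (int \<Rightarrow> 'a \<Rightarrow> real) \<Rightarrow> (int \<Rightarrow> 'a measure)
      \<Rightarrow> (int \<Rightarrow> 'a measure) \<Rightarrow> (int \<Rightarrow> 'a measure) \<Rightarrow> bool" where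
  "enlarges M X I C D \<longleftrightarrow>
     (\<forall>t. subalgebra (D t) (C t) \<and> subalgebra (I t) (D t) \<and>
          \<not> subalgebra (D t) (gen_sigma M X {..t}))"

text \<open>
  \<open>Adm\<close> is the class of admissible enlargements.  It is a parameter, because admitting every
  family allowed by \<open>enlarges\<close> would be too much: adjoining only the single variable \<open>X t\<close> is
  allowed there, but by the Markov property it destroys Granger causality.
\<close>

definition causally_sufficient ::
    "'a measure \<Rightarrow> (real \<Rightarrow> real) \<Rightarrow> (int \<Rightarrow> 'a \<Rightarrow> real) \<Rightarrow> (int \<Rightarrow> 'a \<Rightarrow> real)
      \<Rightarrow> (int \<Rightarrow> 'a measure) \<Rightarrow> (int \<Rightarrow> 'a measure) set \<Rightarrow> (int \<Rightarrow> 'a measure) \<Rightarrow> bool" where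
  "causally_sufficient M F X Y I Adm C \<longleftrightarrow>
     (\<forall>D\<in>Adm. enlarges M X I C D \<and>
        (granger_causes M X Y D \<longleftrightarrow> granger_causes M X Y C) \<and>
        (tail_coeffs_well_defined M F X Y D \<longrightarrow>
           (tail_causes M F X Y D \<longleftrightarrow> tail_causes M F X Y C)))"


section \<open>Structural generation of the response\<close>

text \<open>
  \<open>N\<close> is the space of noise values; \<open>A\<close> is the set of admissible values \<open>(y, z, e)\<close>.
\<close>

definition structurally_generated ::
    "'a measure \<Rightarrow> (int \<Rightarrow> 'a \<Rightarrow> real) \<Rightarrow> (int \<Rightarrow> 'a \<Rightarrow> real)
      \<Rightarrow> (int \<Rightarrow> 'a \<Rightarrow> 'z::euclidean_space) \<Rightarrow> 'e measure \<Rightarrow> (int \<Rightarrow> 'a \<Rightarrow> 'e)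
      \<Rightarrow> (real \<Rightarrow> real \<Rightarrow> 'z \<Rightarrow> 'e \<Rightarrow> real) \<Rightarrow> (real \<times> 'z \<times> 'e) set \<Rightarrow> bool" where
  "structurally_generated M X Y Z N \<epsilon> h A \<longleftrightarrow>
     strictly_stationary M (joint X Y Z) \<and>
     (\<lambda>(x, y, z, e). h x y z e) \<in> borel_measurable (borel \<Otimes>\<^sub>M borel \<Otimes>\<^sub>M borel \<Otimes>\<^sub>M N) \<and>
     A \<in> sets (borel \<Otimes>\<^sub>M borel \<Otimes>\<^sub>M N) \<and>
     (\<forall>t. \<epsilon> t \<in> measurable M N \<and>
          prob_space.indep_set M (sets (vimage_algebra (space M) (\<epsilon> t) N))
            (sets (gen_sigma M (joint X Y Z) {..<t})) \<and>
          (AE \<omega> in M. (Y (t-1) \<omega>, Z (t-1) \<omega>, \<epsilon> t \<omega>) \<in> A) \<and>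
          (AE \<omega> in M. Y t \<omega> = h (X (t-1) \<omega>) (Y (t-1) \<omega>) (Z (t-1) \<omega>) (\<epsilon> t \<omega>)))"

end

theory Submission
  imports Defs
begin

text \<open>
  (i) If the response is conditionally independent of the past of \<open>X\<close>, then conditioning on
  an exceedance of \<open>X\<close> does not change the conditional expectation of \<open>F (Y (t+1))\<close>, so every tail
  coefficient equals the baseline.

  (ii) The noise is independent of the whole past, so conditioning on the past integrates it out:
  \<open>F (Y (t+1))\<close> becomes \<open>\<psi> (X t, Y t, Z t)\<close>.  If \<open>h\<close> is constant in \<open>x\<close>, the same computation with
  indicators in place of \<open>F\<close> excludes Granger causality.  If \<open>h\<close> diverges, then
  \<open>\<psi> (x, y, z) \<rightarrow> 1\<close> as \<open>x \<rightarrow> \<infinity>\<close> for almost every \<open>(y, z)\<close>, though not uniformly, and the threshold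
  beyond which \<open>\<psi> > b\<close> may fail to be a measurable function of \<open>(y, z)\<close>.  Discarding a null set makes
  the projections of the exceptional sets \<open>{x > n, \<psi> < b}\<close> Borel; outside the \<open>n\<close>-th projection all
  conditional expectations given \<open>X t > m\<close> with \<open>m \<ge> n\<close> are at least \<open>b\<close>, and
  no \<open>(y, z)\<close> lies in all projections.  Hence the tail coefficient is at least \<open>1\<close>, whereas the baseline is below \<open>1\<close> because \<open>F < 1\<close>.
\<close>

section \<open>Generated sigma-algebras\<close>

lemma vimage_sets_subset_Pow:
  "(\<Union>s\<in>S. sets (vimage_algebra \<Omega> (V s) borel)) \<subseteq> Pow \<Omega>"
  using sets.sets_into_space by fastforce

lemma space_gen_sigma [simp]: "space (gen_sigma M V S) = space M"
  unfolding gen_sigma_def using vimage_sets_subset_Pow by (simp add: space_measure_of_conv)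

lemma sets_gen_sigma:
  "sets (gen_sigma M V S)
     = sigma_sets (space M) (\<Union>s\<in>S. sets (vimage_algebra (space M) (V s) borel))"
  unfolding gen_sigma_def by (rule sets_measure_of[OF vimage_sets_subset_Pow])

lemma measurable_gen_sigma:
  assumes "s \<in> S"
  shows "V s \<in> borel_measurable (gen_sigma M V S)"
proof (rule measurableI)
  fix A :: "'b set" assume "A \<in> sets borel"
  then have "V s -` A \<inter> space M \<in> sets (vimage_algebra (space M) (V s) borel)"
    by (rule in_vimage_algebra)
  then show "V s -` A \<inter> space (gen_sigma M V S) \<in> sets (gen_sigma M V S)"
    using assms by (auto simp: sets_gen_sigma)
qed simp

lemma subalgebra_gen_sigma:
  assumes "space K = space M" and "\<And>s. s \<in> S \<Longrightarrow> V s \<in> borel_measurable K"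
  shows "subalgebra K (gen_sigma M V S)"
proof -
  have "(\<Union>s\<in>S. sets (vimage_algebra (space M) (V s) borel)) \<subseteq> sets K"
    using assms by (intro UN_least sets_image_in_sets) auto
  then have "sets (gen_sigma M V S) \<subseteq> sets K"
    unfolding sets_gen_sigma using assms(1) by (metis sets.sigma_sets_subset)
  then show ?thesis
    using assms(1) by (simp add: subalgebra_def)
qed

text \<open>The preimages under one variable already form a sigma-algebra, so generating adds
  nothing. Events of the response can thus be handled as preimages of Borel sets.\<close>

lemma sets_gen_sigma_singleton:
  "sets (gen_sigma M V {t}) = {V t -` S \<inter> space M | S. S \<in> sets borel}"
proof -
  have "sets (gen_sigma M V {t}) = sets (vimage_algebra (space M) (V t) borel)"
    unfolding sets_gen_sigma using sets.sigma_sets_eq[of "vimage_algebra (space M) (V t) borel"]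
    by simp
  then show ?thesis
    by (simp add: sets_vimage_algebra2)
qed


section \<open>Conditional expectations\<close>

context prob_space
begin

lemma sigma_finite_subalgebraI:
  assumes "subalgebra M G"
  shows "sigma_finite_subalgebra M G"
proof -
  interpret finite_measure_subalgebra M G
    by unfold_locales (fact assms)
  show ?thesis by unfold_locales
qed

lemma abs_expectation_le:
  fixes f :: "'a \<Rightarrow> real"
  assumes "\<And>\<omega>. \<bar>f \<omega>\<bar> \<le> c"
  shows "\<bar>expectation f\<bar> \<le> c"
proof (cases "integrable M f")
  case True
  have "\<bar>expectation f\<bar> \<le> expectation (\<lambda>\<omega>. \<bar>f \<omega>\<bar>)"
    by (rule integral_abs_bound)
  also have "\<dots> \<le> expectation (\<lambda>_. c)"
    using True assms by (intro integral_mono) auto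
  finally show ?thesis
    by (simp add: prob_space)
next
  \<comment> \<open>Without integrability the Bochner integral is 0 by convention; the bound at any
    one point, here \<open>undefined\<close>, gives 0 \<le> c.\<close>
  case False
  then show ?thesis
    using assms[of undefined] by (simp add: not_integrable_integral_eq)
qed

text \<open>The tower property in the form used later: whatever has been computed given the finer
  \<open>G\<close> may be substituted before conditioning on the coarser \<open>K\<close>.\<close>

lemma cond_exp_AE_eqI:
  assumes "subalgebra M G" "subalgebra G K"
    and "integrable M f" "g \<in> borel_measurable M"
    and "AE \<omega> in M. real_cond_exp M G f \<omega> = g \<omega>"
  shows "AE \<omega> in M. real_cond_exp M K f \<omega> = real_cond_exp M K g \<omega>"
proof -
  have "subalgebra M K"
    using assms(1,2) by (auto simp: subalgebra_def)
  then interpret K: sigma_finite_subalgebra M K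
    by (rule sigma_finite_subalgebraI)
  interpret G: sigma_finite_subalgebra M G
    by (rule sigma_finite_subalgebraI) fact
  have "AE \<omega> in M. real_cond_exp M K (real_cond_exp M G f) \<omega> = real_cond_exp M K f \<omega>"
    using assms by (intro K.real_cond_exp_nested_subalg)
  moreover have "AE \<omega> in M. real_cond_exp M K (real_cond_exp M G f) \<omega> = real_cond_exp M K g \<omega>"
    using assms by (intro K.real_cond_exp_cong) auto
  ultimately show ?thesis by eventually_elim simp
qed

text \<open>Conditional independence is defined on events; here one side is extended to bounded
  functions such as F of the response. Instead of approximating \<open>f\<close> by simple
  functions, the proof fixes a test set in \<open>G\<close> and conditions on \<open>H\<close>:
  \<open>f\<close> is orthogonal to every integrable variable whose conditional expectation given
  \<open>H\<close> vanishes.\<close>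

lemma cond_indep_real_cond_exp:
  fixes f :: "'a \<Rightarrow> real"
  assumes indep: "cond_indep M H K G"
    and sub: "subalgebra M H" "subalgebra M K" "subalgebra M G"
    and B: "B \<in> sets K"
    and f [measurable]: "f \<in> borel_measurable H" and bdd: "\<And>\<omega>. \<bar>f \<omega>\<bar> \<le> c"
  shows "AE \<omega> in M. real_cond_exp M G (\<lambda>\<omega>. f \<omega> * indicator B \<omega>) \<omega>
                  = real_cond_exp M G f \<omega> * cond_prob_given M G B \<omega>"
proof -
  interpret H: sigma_finite_subalgebra M H
    by (rule sigma_finite_subalgebraI) fact
  interpret G: sigma_finite_subalgebra M G
    by (rule sigma_finite_subalgebraI) fact
  have [measurable]: "B \<in> sets M"
    using B sub by (auto simp: subalgebra_def)
  have fM [measurable]: "f \<in> borel_measurable M"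
    using measurable_from_subalg[OF sub(1) f] .
  define p where "p = cond_prob_given M G B"
  have pG [measurable]: "p \<in> borel_measurable G"
    unfolding p_def cond_prob_given_def by simp
  have pM [measurable]: "p \<in> borel_measurable M"
    using measurable_from_subalg[OF sub(3) pG] .
  have ip: "integrable M p"
    unfolding p_def cond_prob_given_def
    by (intro G.real_cond_exp_int integrable_real_indicator) (auto simp: emeasure_eq_measure)
  have bint: "integrable M (\<lambda>\<omega>. g \<omega> * k \<omega>)"
    if "integrable M k" "g \<in> borel_measurable M" "\<And>\<omega>. \<bar>g \<omega>\<bar> \<le> b" for g k :: "'a \<Rightarrow> real" and b
  proof (rule Bochner_Integration.integrable_bound)
    show "integrable M (\<lambda>\<omega>. b * k \<omega>)" using that by simp
    have "\<bar>g \<omega>\<bar> * \<bar>k \<omega>\<bar> \<le> \<bar>b\<bar> * \<bar>k \<omega>\<bar>" for \<omega>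
      by (intro mult_right_mono order_trans[OF that(3) abs_ge_self]) simp
    then show "AE \<omega> in M. norm (g \<omega> * k \<omega>) \<le> norm (b * k \<omega>)"
      by (simp add: abs_mult)
  qed (use that in simp)
  have fi: "integrable M f"
    using bdd by (intro integrable_const_bound[where B = c]) auto
  have fp: "integrable M (\<lambda>\<omega>. f \<omega> * p \<omega>)"
    by (rule bint[OF ip fM bdd])
  have key: "(\<integral>\<omega>\<in>D. f \<omega> * indicator B \<omega> \<partial>M) = (\<integral>\<omega>\<in>D. f \<omega> * p \<omega> \<partial>M)" if D: "D \<in> sets G" for D
  proof -
    have [measurable]: "D \<in> sets M" using D sub by (auto simp: subalgebra_def)
    \<comment> \<open>Conditional independence makes \<open>w\<close> orthogonal to the indicators of sets in \<open>H\<close>, hence to \<open>f\<close>.\<close>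
    define w where "w = (\<lambda>\<omega>. indicator D \<omega> * (indicator B \<omega> - p \<omega>) :: real)"
    have wM [measurable]: "w \<in> borel_measurable M" unfolding w_def by measurable
    have wi: "integrable M w"
    proof -
      have "integrable M (\<lambda>\<omega>. indicator B \<omega> - p \<omega>)"
        by (intro Bochner_Integration.integrable_diff ip integrable_real_indicator)
          (auto simp: emeasure_eq_measure)
      then show ?thesis
        unfolding w_def using integrable_mult_indicator[of D M "\<lambda>\<omega>. indicator B \<omega> - p \<omega>"] by simp
    qed
    \<comment> \<open>As \<open>p\<close> is measurable for \<open>G\<close>, conditional
      independence says that the indicator of A \<inter> B and \<open>p\<close> times the indicator
      of \<open>A\<close> have the same conditional expectation given \<open>G\<close>, hence equal
      integrals over \<open>D\<close>.\<close>
    have zero: "(\<integral>\<omega>\<in>A. w \<omega> \<partial>M) = (\<integral>\<omega>\<in>A. 0 \<partial>M)" if A: "A \<in> sets H" for A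
    proof -
      have [measurable]: "A \<in> sets M" using A sub by (auto simp: subalgebra_def)
      have ApI: "integrable M (\<lambda>\<omega>. p \<omega> * indicator A \<omega>)"
        using integrable_mult_indicator[OF _ ip, of A] by (simp add: mult.commute)
      have "AE \<omega> in M. real_cond_exp M G (indicator (A \<inter> B)) \<omega>
              = p \<omega> * real_cond_exp M G (indicator A) \<omega>"
        using indep A B unfolding cond_indep_def p_def cond_prob_given_def
        by (auto simp: mult.commute)
      moreover have "AE \<omega> in M. real_cond_exp M G (\<lambda>\<omega>. p \<omega> * indicator A \<omega>) \<omega>
              = p \<omega> * real_cond_exp M G (indicator A) \<omega>"
        by (rule G.real_cond_exp_mult[OF pG _ ApI]) simp
      ultimately have "AE \<omega> in M. real_cond_exp M G (indicator (A \<inter> B)) \<omega>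
              = real_cond_exp M G (\<lambda>\<omega>. p \<omega> * indicator A \<omega>) \<omega>"
        by eventually_elim simp
      then have "(\<integral>\<omega>\<in>D. real_cond_exp M G (indicator (A \<inter> B)) \<omega> \<partial>M)
          = (\<integral>\<omega>\<in>D. real_cond_exp M G (\<lambda>\<omega>. p \<omega> * indicator A \<omega>) \<omega> \<partial>M)"
        unfolding set_lebesgue_integral_def
        by (intro integral_cong_AE) auto
      then have "(\<integral>\<omega>\<in>D. indicator (A \<inter> B) \<omega> \<partial>M) = (\<integral>\<omega>\<in>D. p \<omega> * indicator A \<omega> \<partial>M)"
        using G.real_cond_exp_intA[OF _ D, of "indicator (A \<inter> B)"] G.real_cond_exp_intA[OF ApI D]
        by (simp add: emeasure_eq_measure)
      moreover have "(\<integral>\<omega>\<in>A. w \<omega> \<partial>M)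
          = (\<integral>\<omega>\<in>D. indicator (A \<inter> B) \<omega> \<partial>M) - (\<integral>\<omega>\<in>D. p \<omega> * indicator A \<omega> \<partial>M)"
      proof -
        have "(\<integral>\<omega>\<in>A. w \<omega> \<partial>M)
            = (\<integral>\<omega>. indicator D \<omega> *\<^sub>R indicator (A \<inter> B) \<omega> - indicator D \<omega> *\<^sub>R (p \<omega> * indicator A \<omega>) \<partial>M)"
          unfolding set_lebesgue_integral_def w_def
          by (intro Bochner_Integration.integral_cong) (auto simp: indicator_def algebra_simps)
        also have "\<dots> = (\<integral>\<omega>\<in>D. indicator (A \<inter> B) \<omega> \<partial>M) - (\<integral>\<omega>\<in>D. p \<omega> * indicator A \<omega> \<partial>M)"
          unfolding set_lebesgue_integral_def
          by (intro Bochner_Integration.integral_diff integrable_mult_indicator ApI)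
            (auto simp: emeasure_eq_measure)
        finally show ?thesis .
      qed
      ultimately show ?thesis by (simp add: set_lebesgue_integral_def)
    qed
    have w0: "AE \<omega> in M. real_cond_exp M H w \<omega> = 0"
      by (rule H.real_cond_exp_charact[OF zero wi]) auto
    have "(\<integral>\<omega>. f \<omega> * w \<omega> \<partial>M) = (\<integral>\<omega>. f \<omega> * real_cond_exp M H w \<omega> \<partial>M)"
      by (rule H.real_cond_exp_intg(2)[symmetric]) (auto intro: bint[OF wi fM bdd])
    also have "\<dots> = 0"
      using w0 by (intro integral_eq_zero_AE) auto
    finally have "(\<integral>\<omega>. f \<omega> * w \<omega> \<partial>M) = 0" .
    moreover have "(\<integral>\<omega>. f \<omega> * w \<omega> \<partial>M)
        = (\<integral>\<omega>\<in>D. f \<omega> * indicator B \<omega> \<partial>M) - (\<integral>\<omega>\<in>D. f \<omega> * p \<omega> \<partial>M)"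
    proof -
      have "(\<integral>\<omega>. f \<omega> * w \<omega> \<partial>M)
          = (\<integral>\<omega>. indicator D \<omega> *\<^sub>R (f \<omega> * indicator B \<omega>) - indicator D \<omega> *\<^sub>R (f \<omega> * p \<omega>) \<partial>M)"
        unfolding w_def by (intro Bochner_Integration.integral_cong) (auto simp: algebra_simps)
      also have "\<dots> = (\<integral>\<omega>\<in>D. f \<omega> * indicator B \<omega> \<partial>M) - (\<integral>\<omega>\<in>D. f \<omega> * p \<omega> \<partial>M)"
        unfolding set_lebesgue_integral_def
        by (intro Bochner_Integration.integral_diff integrable_mult_indicator fp
            integrable_real_mult_indicator fi) auto
      finally show ?thesis .
    qed
    ultimately show ?thesis by simp
  qed
  have pf: "integrable M (\<lambda>\<omega>. p \<omega> * f \<omega>)"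
    using fp by (simp add: mult.commute)
  have fB: "integrable M (\<lambda>\<omega>. f \<omega> * indicator B \<omega>)"
    by (intro integrable_real_mult_indicator fi) simp
  have "AE \<omega> in M. real_cond_exp M G (\<lambda>\<omega>. f \<omega> * indicator B \<omega>) \<omega>
          = p \<omega> * real_cond_exp M G f \<omega>"
  proof (rule G.real_cond_exp_charact)
    fix D assume D: "D \<in> sets G"
    \<comment> \<open>\<open>key\<close> has \<open>p\<close> times \<open>f\<close> under the
      integral, which is not measurable for \<open>G\<close>. Pulling \<open>p\<close> out of its
      conditional expectation gives the measurable candidate with the same integrals over
      \<open>D\<close>.\<close>
    have eq: "AE \<omega> in M. real_cond_exp M G (\<lambda>\<omega>. p \<omega> * f \<omega>) \<omega> = p \<omega> * real_cond_exp M G f \<omega>"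
      by (rule G.real_cond_exp_mult[OF pG fM pf])
    have [measurable]: "D \<in> sets M" using D sub by (auto simp: subalgebra_def)
    have "(\<integral>\<omega>\<in>D. f \<omega> * indicator B \<omega> \<partial>M) = (\<integral>\<omega>\<in>D. p \<omega> * f \<omega> \<partial>M)"
      using key[OF D] by (simp add: mult.commute)
    also have "\<dots> = (\<integral>\<omega>\<in>D. real_cond_exp M G (\<lambda>\<omega>. p \<omega> * f \<omega>) \<omega> \<partial>M)"
      by (rule G.real_cond_exp_intA[OF pf D])
    also have "\<dots> = (\<integral>\<omega>\<in>D. p \<omega> * real_cond_exp M G f \<omega> \<partial>M)"
      unfolding set_lebesgue_integral_def using eq
      by (intro integral_cong_AE) auto
    finally show "(\<integral>\<omega>\<in>D. f \<omega> * indicator B \<omega> \<partial>M) = (\<integral>\<omega>\<in>D. p \<omega> * real_cond_exp M G f \<omega> \<partial>M)" .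
  next
    show "integrable M (\<lambda>\<omega>. p \<omega> * real_cond_exp M G f \<omega>)"
      by (rule G.real_cond_exp_intg(1)[OF pf]) auto
  qed (auto intro: fB)
  then show ?thesis
    by (simp add: p_def mult.commute)
qed

text \<open>Freezing: given \<open>G\<close>, the known \<open>U\<close> acts as a constant while
  the independent noise keeps its law. The candidate is verified by integrating over an arbitrary
  set of \<open>G\<close> and applying Fubini.\<close>

lemma real_cond_exp_freeze:
  fixes f :: "'u \<times> 'e \<Rightarrow> real"
  assumes sub: "subalgebra M G"
    and eps: "\<epsilon> \<in> measurable M N"
    and indep: "indep_set (sets (vimage_algebra (space M) \<epsilon> N)) (sets G)"
    and U: "U \<in> measurable G S"
    and f [measurable]: "f \<in> borel_measurable (S \<Otimes>\<^sub>M N)" and bdd: "\<And>q. \<bar>f q\<bar> \<le> c"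
  shows "AE \<omega> in M. real_cond_exp M G (\<lambda>\<omega>. f (U \<omega>, \<epsilon> \<omega>)) \<omega>
                  = (\<integral>e. f (U \<omega>, e) \<partial>distr M N \<epsilon>)"
proof -
  interpret G: sigma_finite_subalgebra M G
    by (rule sigma_finite_subalgebraI) fact
  note eps [measurable]
  have UM [measurable]: "U \<in> measurable M S"
    using measurable_from_subalg[OF sub U] .
  define L where "L = distr M N \<epsilon>"
  interpret L: prob_space L
    unfolding L_def by (rule prob_space_distr) fact
  have setsL [measurable_cong]: "sets L = sets N" by (simp add: L_def)
  define \<psi> where "\<psi> = (\<lambda>u. \<integral>e. f (u, e) \<partial>L)"
  have psi [measurable]: "\<psi> \<in> borel_measurable S"
    unfolding \<psi>_def by measurable
  have psiU: "(\<lambda>\<omega>. \<psi> (U \<omega>)) \<in> borel_measurable G"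
    using measurable_compose[OF U psi] .
  have "\<bar>\<psi> u\<bar> \<le> c" for u
    unfolding \<psi>_def by (rule L.abs_expectation_le) (rule bdd)
  then have psiI: "integrable M (\<lambda>\<omega>. \<psi> (U \<omega>))"
    by (intro integrable_const_bound[where B = c]) auto
  have fI: "integrable M (\<lambda>\<omega>. f (U \<omega>, \<epsilon> \<omega>))"
    using bdd by (intro integrable_const_bound[where B = c]) auto
  have "(\<integral>\<omega>\<in>B. f (U \<omega>, \<epsilon> \<omega>) \<partial>M) = (\<integral>\<omega>\<in>B. \<psi> (U \<omega>) \<partial>M)" if B: "B \<in> sets G" for B
  proof -
    have [measurable]: "B \<in> sets M" using B sub by (auto simp: subalgebra_def)
    \<comment> \<open>The indicator of the test set travels along as an extra coordinate, so that
      the integral over \<open>B\<close> becomes a plain integral against the joint law of noise and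
      \<open>P\<close>.\<close>
    define P where "P = (\<lambda>\<omega>. (U \<omega>, indicator B \<omega> :: real))"
    have PG: "P \<in> measurable G (S \<Otimes>\<^sub>M borel)"
      unfolding P_def using U B by measurable
    have PM [measurable]: "P \<in> measurable M (S \<Otimes>\<^sub>M borel)"
      using measurable_from_subalg[OF sub PG] .
    have spG: "space G = space M" using sub by (simp add: subalgebra_def)
    define LP where "LP = distr M (S \<Otimes>\<^sub>M borel) P"
    interpret LP: prob_space LP
      unfolding LP_def by (rule prob_space_distr) fact
    \<comment> \<open>\<open>P\<close> is measurable for \<open>G\<close>, hence independent of the
      noise; checking rectangles identifies the joint law with the product.\<close>
    have eq: "L \<Otimes>\<^sub>M LP
        = distr M (N \<Otimes>\<^sub>M (S \<Otimes>\<^sub>M borel)) (\<lambda>\<omega>. (\<epsilon> \<omega>, P \<omega>))"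
    proof (rule pair_measure_eqI)
      fix A and Q :: "('u \<times> real) set"
      assume "A \<in> sets L" and "Q \<in> sets (LP)"
      then have A [measurable]: "A \<in> sets N" and Q [measurable]: "Q \<in> sets (S \<Otimes>\<^sub>M borel)"
        by (auto simp: L_def LP_def)
      have "P -` Q \<inter> space M \<in> sets G"
        using measurable_sets[OF PG Q] spG by simp
      then have "prob ((\<epsilon> -` A \<inter> space M) \<inter> (P -` Q \<inter> space M))
          = prob (\<epsilon> -` A \<inter> space M) * prob (P -` Q \<inter> space M)"
        using indep in_vimage_algebra[OF A] by (intro indep_setD) auto
      moreover have "(\<epsilon> -` A \<inter> space M) \<inter> (P -` Q \<inter> space M)
          = (\<lambda>\<omega>. (\<epsilon> \<omega>, P \<omega>)) -` (A \<times> Q) \<inter> space M"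
        by auto
      ultimately show "emeasure L A * emeasure (LP) Q
          = emeasure (distr M (N \<Otimes>\<^sub>M (S \<Otimes>\<^sub>M borel)) (\<lambda>\<omega>. (\<epsilon> \<omega>, P \<omega>))) (A \<times> Q)"
        by (simp add: L_def LP_def emeasure_distr emeasure_eq_measure ennreal_mult)
    next
      show "sets (L \<Otimes>\<^sub>M LP)
          = sets (distr M (N \<Otimes>\<^sub>M S \<Otimes>\<^sub>M borel) (\<lambda>\<omega>. (\<epsilon> \<omega>, P \<omega>)))"
        unfolding L_def LP_def sets_distr by (intro sets_pair_measure_cong sets_distr)
    qed (fact L.sigma_finite_measure_axioms LP.sigma_finite_measure_axioms)+
    interpret LL: pair_sigma_finite L LP ..
    define k where "k = (\<lambda>(e, u, r). r * f (u, e) :: real)"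
    have k [measurable]: "k \<in> borel_measurable (N \<Otimes>\<^sub>M (S \<Otimes>\<^sub>M borel))"
      unfolding k_def by measurable
    have kk: "k (\<epsilon> \<omega>, P \<omega>) = indicator B \<omega> *\<^sub>R f (U \<omega>, \<epsilon> \<omega>)" for \<omega>
      by (simp add: k_def P_def)
    have kI: "integrable (L \<Otimes>\<^sub>M LP) k"
      unfolding eq by (subst integrable_distr_eq)
        (auto simp: kk simp del: real_scaleR_def intro!: integrable_mult_indicator fI)
    have "(\<integral>\<omega>\<in>B. f (U \<omega>, \<epsilon> \<omega>) \<partial>M) = integral\<^sup>L (L \<Otimes>\<^sub>M LP) k"
      unfolding eq by (subst integral_distr) (auto simp: kk set_lebesgue_integral_def)
    also have "\<dots> = (\<integral>q. (\<integral>e. k (e, q) \<partial>L) \<partial>LP)"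
      using LL.integral_snd[of "\<lambda>e q. k (e, q)"] kI by simp
    also have "\<dots> = (\<integral>\<omega>. (\<integral>e. k (e, P \<omega>) \<partial>L) \<partial>M)"
      unfolding LP_def by (rule integral_distr) measurable
    also have "\<dots> = (\<integral>\<omega>\<in>B. \<psi> (U \<omega>) \<partial>M)"
      by (simp add: k_def P_def set_lebesgue_integral_def \<psi>_def)
    finally show ?thesis .
  qed
  from G.real_cond_exp_charact[OF this fI psiI psiU] show ?thesis
    by (simp add: \<psi>_def L_def)
qed

end


section \<open>Tail coefficients\<close>

text \<open>Each version \<open>R v\<close> has its own exceptional null set. Along integer
  thresholds there are only countably many, so the chosen versions can be replaced by
  \<open>cond_exp_exceed\<close> itself.\<close>

lemma tail_coeff_LIMSEQ:
  assumes "is_tail_coeff M F X Y C t \<Gamma>"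
  shows "AE \<omega> in M.
    (\<lambda>n. cond_exp_exceed M (C t) (\<lambda>\<omega>'. F (Y (t+1) \<omega>')) (X t) (real n) \<omega>) \<longlonglongrightarrow> \<Gamma> \<omega>"
proof -
  obtain R where
    R: "\<And>v. AE \<omega> in M. R v \<omega> = cond_exp_exceed M (C t) (\<lambda>\<omega>'. F (Y (t+1) \<omega>')) (X t) v \<omega>"
    and lim: "AE \<omega> in M. ((\<lambda>v. R v \<omega>) \<longlongrightarrow> \<Gamma> \<omega>) at_top"
    using assms unfolding is_tail_coeff_def by blast
  have "AE \<omega> in M. \<forall>n::nat. R (real n) \<omega>
      = cond_exp_exceed M (C t) (\<lambda>\<omega>'. F (Y (t+1) \<omega>')) (X t) (real n) \<omega>"
    by (subst AE_all_countable) (intro allI R)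
  with lim show ?thesis
  proof eventually_elim
    case (elim \<omega>)
    have "(\<lambda>n. R (real n) \<omega>) \<longlonglongrightarrow> \<Gamma> \<omega>"
      using elim(1) by (rule filterlim_compose) (rule filterlim_real_sequentially)
    then show ?case
      using elim(2) by simp
  qed
qed

text \<open>The exceedance event belongs to the past of \<open>X\<close>, so the numerator of the
  conditional expectation factorises and the positive denominator cancels. The sequence of
  thresholds is then almost surely constant, and so is its limit.\<close>

lemma (in prob_space) tail_coeff_eq_baseline:
  assumes [measurable]: "\<And>t. X t \<in> borel_measurable M" "\<And>t. Y t \<in> borel_measurable M"
    and F [measurable]: "F \<in> borel_measurable borel" and bdd: "\<And>x. \<bar>F x\<bar> \<le> c"
    and sub: "subalgebra M (C t)"
    and indep: "cond_indep M (gen_sigma M Y {t+1}) (gen_sigma M X {..t}) (C t)"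
    and pos: "\<And>v. AE \<omega> in M. cond_prob_given M (C t) (exceedance M (X t) v) \<omega> > 0"
    and coeff: "is_tail_coeff M F X Y C t \<Gamma>"
  shows "AE \<omega> in M. \<Gamma> \<omega> = baseline_coeff M F Y C t \<omega>"
proof -
  have ex: "exceedance M (X t) v \<in> sets (gen_sigma M X {..t})" for v
  proof -
    have "X t -` {v<..} \<inter> space (gen_sigma M X {..t}) \<in> sets (gen_sigma M X {..t})"
      by (rule measurable_sets[OF measurable_gen_sigma]) auto
    moreover have "X t -` {v<..} \<inter> space (gen_sigma M X {..t}) = exceedance M (X t) v"
      by (auto simp: exceedance_def)
    ultimately show ?thesis by simp
  qed
  have FY: "(\<lambda>\<omega>. F (Y (t+1) \<omega>)) \<in> borel_measurable (gen_sigma M Y {t+1})"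
    by (intro measurable_compose[OF measurable_gen_sigma F]) simp
  have "AE \<omega> in M. cond_exp_exceed M (C t) (\<lambda>\<omega>'. F (Y (t+1) \<omega>')) (X t) v \<omega>
      = baseline_coeff M F Y C t \<omega>" for v
  proof -
    have "AE \<omega> in M. real_cond_exp M (C t)
          (\<lambda>\<omega>. F (Y (t+1) \<omega>) * indicator (exceedance M (X t) v) \<omega>) \<omega>
        = real_cond_exp M (C t) (\<lambda>\<omega>. F (Y (t+1) \<omega>)) \<omega>
          * cond_prob_given M (C t) (exceedance M (X t) v) \<omega>"
      by (rule cond_indep_real_cond_exp[OF indep _ _ sub ex FY bdd])
        (intro subalgebra_gen_sigma; simp)+
    with pos[of v] show ?thesis
      by eventually_elim (simp add: cond_exp_exceed_def baseline_coeff_def)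
  qed
  then have "AE \<omega> in M. \<forall>n::nat. cond_exp_exceed M (C t) (\<lambda>\<omega>'. F (Y (t+1) \<omega>')) (X t) (real n) \<omega>
      = baseline_coeff M F Y C t \<omega>"
    by (subst AE_all_countable) simp
  with tail_coeff_LIMSEQ[OF coeff] show ?thesis
    by eventually_elim (simp add: LIMSEQ_const_iff)
qed


section \<open>Essential projections\<close>

text \<open>
  The projection of a Borel set need not be Borel, but up to a null set the Borel set is
  sigma-compact, and projections of sigma-compact sets are.
\<close>

lemma essential_projection:
  fixes \<nu> :: "('a::{second_countable_topology, complete_space}
                 \<times> 'b::{second_countable_topology, complete_space}) measure"
  assumes "finite_measure \<nu>" and sets: "sets \<nu> = sets borel" and S: "S \<in> sets borel"
  obtains P where "P \<in> sets borel" "P \<subseteq> snd ` S" "AE q in \<nu>. q \<in> S \<longrightarrow> snd q \<in> P"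
proof -
  interpret finite_measure \<nu> by fact
  have "emeasure \<nu> S = (SUP K \<in> {K. K \<subseteq> S \<and> compact K}. emeasure \<nu> K)"
    by (rule inner_regular[OF sets _ S]) simp
  moreover have "{K. K \<subseteq> S \<and> compact K} \<noteq> {}"
    by (auto intro: exI[of _ "{}"])
  ultimately obtain f :: "nat \<Rightarrow> ennreal" where
    f: "range f \<subseteq> emeasure \<nu> ` {K. K \<subseteq> S \<and> compact K}" "emeasure \<nu> S = (SUP i. f i)"
    using ennreal_Sup_countable_SUP[of "emeasure \<nu> ` {K. K \<subseteq> S \<and> compact K}"] by auto
  then have "\<forall>i. \<exists>K. K \<subseteq> S \<and> compact K \<and> f i = emeasure \<nu> K"
    by (auto simp: image_subset_iff image_iff)
  then obtain K where K: "\<And>i. K i \<subseteq> S" "\<And>i. compact (K i)" "\<And>i. f i = emeasure \<nu> (K i)"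
    by metis
  have Kb: "(\<Union>i. K i) \<in> sets \<nu>"
    unfolding sets using K(2) by (intro sets.countable_UN) (auto intro: borel_compact)
  \<comment> \<open>The compact sets need not increase: their union bounds each of their measures,
    hence the supremum.\<close>
  have "emeasure \<nu> S \<le> emeasure \<nu> (\<Union>i. K i)"
    unfolding f(2) K(3) using Kb by (intro SUP_least emeasure_mono) auto
  moreover have "emeasure \<nu> (S - (\<Union>i. K i)) = emeasure \<nu> S - emeasure \<nu> (\<Union>i. K i)"
    using K(1) S sets Kb by (intro emeasure_Diff) (auto simp: emeasure_eq_measure)
  ultimately have "emeasure \<nu> (S - (\<Union>i. K i)) = 0"
    by (simp add: diff_eq_0_iff_ennreal emeasure_eq_measure less_top[symmetric])
  then have "S - (\<Union>i. K i) \<in> null_sets \<nu>"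
    using S sets Kb by (intro null_setsI) auto
  then have ae: "AE q in \<nu>. q \<in> S \<longrightarrow> snd q \<in> (\<Union>i. snd ` K i)"
    by (rule AE_I') auto
  have "compact (snd ` K i)" for i
    by (intro compact_continuous_image continuous_on_snd continuous_on_id K(2))
  then have "(\<Union>i. snd ` K i) \<in> sets borel"
    by (intro sets.countable_UN) (auto intro: borel_compact)
  \<comment> \<open>Staying inside the true projection matters: every point of the Borel substitute
    has a genuine witness in \<open>S\<close>.\<close>
  moreover have "(\<Union>i. snd ` K i) \<subseteq> snd ` S"
    using K(1) by blast
  ultimately show thesis
    using ae by (rule that)
qed

text \<open>\<open>P n\<close> is a Borel substitute for the set of those u at which \<psi> still
  falls below \<open>b\<close> somewhere beyond n. It takes the place of a measurable threshold
  depending on u.\<close>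

lemma (in prob_space) tail_lower_bound:
  fixes \<psi> :: "real \<times> 'b::{second_countable_topology, complete_space} \<Rightarrow> real"
  assumes X [measurable]: "X \<in> borel_measurable M" and V [measurable]: "V \<in> borel_measurable M"
    and psi [measurable]: "\<psi> \<in> borel_measurable borel" and T [measurable]: "T \<in> sets borel"
    and VT: "AE \<omega> in M. V \<omega> \<in> T"
    and lim: "\<And>u. u \<in> T \<Longrightarrow> ((\<lambda>x. \<psi> (x, u)) \<longlongrightarrow> l) at_top" and b: "b < l"
  obtains P :: "nat \<Rightarrow> 'b set" where "\<And>n. P n \<in> sets borel" "(\<Inter>n. P n) = {}"
    "\<And>n. AE \<omega> in M. V \<omega> \<notin> P n \<longrightarrow> X \<omega> > real n \<longrightarrow> \<psi> (X \<omega>, V \<omega>) \<ge> b"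
proof -
  define \<nu> where "\<nu> = distr M borel (\<lambda>\<omega>. (X \<omega>, V \<omega>))"
  have XV [measurable]: "(\<lambda>\<omega>. (X \<omega>, V \<omega>)) \<in> borel_measurable M"
    by measurable
  interpret \<nu>: prob_space \<nu>
    unfolding \<nu>_def by (rule prob_space_distr) fact
  \<comment> \<open>Restricting to \<open>T\<close> costs only a null set and ensures that every
    point of \<open>P n\<close> lies where the limit is known.\<close>
  define S where "S n = {q. fst q > real n \<and> \<psi> q < b \<and> snd q \<in> T}" for n :: nat
  have [measurable]: "fst \<in> borel_measurable (borel :: (real \<times> 'b) measure)"
    "snd \<in> borel_measurable (borel :: (real \<times> 'b) measure)"
    by (auto intro!: borel_measurable_continuous_onI continuous_intros)
  have S: "S n \<in> sets borel" for n
    unfolding S_def by measurable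
  have "\<exists>P. P \<in> sets borel \<and> P \<subseteq> snd ` S n \<and> (AE q in \<nu>. q \<in> S n \<longrightarrow> snd q \<in> P)" for n
    by (rule essential_projection[OF \<nu>.finite_measure_axioms _ S[of n]]) (auto simp: \<nu>_def)
  then obtain P where P: "\<And>n. P n \<in> sets borel" "\<And>n. P n \<subseteq> snd ` S n"
      "\<And>n. AE q in \<nu>. q \<in> S n \<longrightarrow> snd q \<in> P n"
    by metis
  note P(1) [measurable]
  show thesis
  proof (rule that[OF P(1)])
    \<comment> \<open>Such a u would have points x beyond every n with \<psi> (x, u) < b, against
      the limit \<open>l\<close> > \<open>b\<close>.\<close>
    have False if u: "\<And>n. u \<in> P n" for u
    proof -
      have "u \<in> T"
        using u[of 0] P(2)[of 0] by (auto simp: S_def)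
      then have "eventually (\<lambda>x. b < \<psi> (x, u)) at_top"
        using lim b order_tendstoD(1) by blast
      then obtain x0 where x0: "\<And>x. x \<ge> x0 \<Longrightarrow> b < \<psi> (x, u)"
        by (auto simp: eventually_at_top_linorder)
      obtain n :: nat where n: "x0 \<le> real n"
        using real_arch_simple by blast
      obtain x where "x > real n" "\<psi> (x, u) < b"
        using u[of n] P(2)[of n] by (auto simp: S_def)
      then show False
        using x0[of x] n by simp
    qed
    then show "(\<Inter>n. P n) = {}" by blast
  next
    fix n
    have "AE \<omega> in M. (X \<omega>, V \<omega>) \<in> S n \<longrightarrow> V \<omega> \<in> P n"
      using P(3)[of n] S[of n] unfolding \<nu>_def by (subst (asm) AE_distr_iff) auto
    with VT show "AE \<omega> in M. V \<omega> \<notin> P n \<longrightarrow> X \<omega> > real n \<longrightarrow> \<psi> (X \<omega>, V \<omega>) \<ge> b"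
      by eventually_elim (auto simp: S_def not_le[symmetric])
  qed
qed

text \<open>Conditioning happens in two stages. Given \<open>G\<close>, which sees the exceedance
  event \<open>E\<close>, the function \<open>f\<close> becomes \<psi>, where the pointwise bound is
  available; conditioning on \<open>K\<close> preserves the inequality on \<open>D\<close> because
  \<open>D\<close> is known there.\<close>

lemma (in prob_space) tail_cond_exp_ge:
  fixes \<psi> :: "'a \<Rightarrow> real"
  assumes sub: "subalgebra M G" "subalgebra G K"
    and f: "integrable M f" and cond: "AE \<omega> in M. real_cond_exp M G f \<omega> = \<psi> \<omega>"
    and psi: "integrable M \<psi>"
    and E: "E \<in> sets G" and D: "D \<in> sets K"
    and ge: "AE \<omega> in M. \<omega> \<in> D \<longrightarrow> \<omega> \<in> E \<longrightarrow> \<psi> \<omega> \<ge> b"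
  shows "AE \<omega> in M. \<omega> \<in> D \<longrightarrow>
    real_cond_exp M K (\<lambda>\<omega>. f \<omega> * indicator E \<omega>) \<omega> \<ge> b * cond_prob_given M K E \<omega>"
proof -
  have subK: "subalgebra M K"
    using sub by (auto simp: subalgebra_def)
  interpret G: sigma_finite_subalgebra M G
    by (rule sigma_finite_subalgebraI) fact
  interpret K: sigma_finite_subalgebra M K
    by (rule sigma_finite_subalgebraI) fact
  have [measurable]: "E \<in> sets M" "D \<in> sets M"
    using E D sub by (auto simp: subalgebra_def)
  have [measurable]: "\<psi> \<in> borel_measurable M" "f \<in> borel_measurable M"
    using psi f by auto
  have iE: "(indicator E :: 'a \<Rightarrow> real) \<in> borel_measurable G"
    using E by simp
  have iD: "(indicator D :: 'a \<Rightarrow> real) \<in> borel_measurable K"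
    using D by simp
  have ind: "integrable M (\<lambda>\<omega>. indicator Q \<omega> * g \<omega>)"
    if "integrable M g" "Q \<in> sets M" for g :: "'a \<Rightarrow> real" and Q
    using integrable_mult_indicator[OF that(2,1)] by simp
  have iEM: "integrable M (indicator E :: 'a \<Rightarrow> real)"
    by (intro integrable_real_indicator) (auto simp: emeasure_eq_measure)
  have "AE \<omega> in M. real_cond_exp M G (\<lambda>\<omega>. indicator E \<omega> * f \<omega>) \<omega>
      = indicator E \<omega> * real_cond_exp M G f \<omega>"
    by (rule G.real_cond_exp_mult[OF iE]) (auto intro: ind f)
  with cond have "AE \<omega> in M. real_cond_exp M G (\<lambda>\<omega>. indicator E \<omega> * f \<omega>) \<omega> = indicator E \<omega> * \<psi> \<omega>"
    by eventually_elim simp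
  then have 1: "AE \<omega> in M. real_cond_exp M K (\<lambda>\<omega>. indicator E \<omega> * f \<omega>) \<omega>
      = real_cond_exp M K (\<lambda>\<omega>. indicator E \<omega> * \<psi> \<omega>) \<omega>"
    by (intro cond_exp_AE_eqI[OF sub]) (auto intro: ind f)
  have 2: "AE \<omega> in M. real_cond_exp M K (\<lambda>\<omega>. indicator D \<omega> * (indicator E \<omega> * \<psi> \<omega>)) \<omega>
      = indicator D \<omega> * real_cond_exp M K (\<lambda>\<omega>. indicator E \<omega> * \<psi> \<omega>) \<omega>"
    by (rule K.real_cond_exp_mult[OF iD]) (auto intro!: ind psi)
  have 3: "AE \<omega> in M. real_cond_exp M K (\<lambda>\<omega>. indicator D \<omega> * (b * indicator E \<omega>)) \<omega>
      = indicator D \<omega> * real_cond_exp M K (\<lambda>\<omega>. b * indicator E \<omega>) \<omega>"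
    by (rule K.real_cond_exp_mult[OF iD]) (auto intro!: ind iEM)
  have 4: "AE \<omega> in M. real_cond_exp M K (\<lambda>\<omega>. b * indicator E \<omega>) \<omega> = b * cond_prob_given M K E \<omega>"
    unfolding cond_prob_given_def by (rule K.real_cond_exp_cmult[OF iEM])
  have 5: "AE \<omega> in M. real_cond_exp M K (\<lambda>\<omega>. indicator D \<omega> * (b * indicator E \<omega>)) \<omega>
      \<le> real_cond_exp M K (\<lambda>\<omega>. indicator D \<omega> * (indicator E \<omega> * \<psi> \<omega>)) \<omega>"
  \<comment> \<open>The factor \<open>indicator D\<close> makes the inequality hold almost
    everywhere, with both sides 0 off \<open>D\<close>; by \<open>2\<close> and \<open>3\<close> it
    then comes out of both conditional expectations.\<close>
  proof (rule K.real_cond_exp_mono)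
    show "AE \<omega> in M. indicator D \<omega> * (b * indicator E \<omega>) \<le> indicator D \<omega> * (indicator E \<omega> * \<psi> \<omega>)"
      using ge by eventually_elim (auto simp: indicator_def)
  qed (auto intro!: ind psi iEM)
  from 1 2 3 4 5 show ?thesis
    by eventually_elim (auto simp: mult.commute)
qed

text \<open>For each level b below \<open>l\<close>, almost every path eventually has ratios at
  least b; letting b increase to \<open>l\<close> along a sequence keeps the exceptional set
  null.\<close>

lemma (in prob_space) tail_coeff_ge:
  fixes V :: "'a \<Rightarrow> 'b::{second_countable_topology, complete_space}"
  assumes sub: "subalgebra M G" "subalgebra G (C t)"
    and X: "X t \<in> borel_measurable G" and V: "V \<in> borel_measurable (C t)"
    and f: "integrable M (\<lambda>\<omega>. F (Y (t+1) \<omega>))"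
    and psi [measurable]: "\<psi> \<in> borel_measurable borel" and bdd: "\<And>q. \<bar>\<psi> q\<bar> \<le> c"
    and cond: "AE \<omega> in M. real_cond_exp M G (\<lambda>\<omega>. F (Y (t+1) \<omega>)) \<omega> = \<psi> (X t \<omega>, V \<omega>)"
    and T: "T \<in> sets borel" "AE \<omega> in M. V \<omega> \<in> T"
    and lim: "\<And>u. u \<in> T \<Longrightarrow> ((\<lambda>x. \<psi> (x, u)) \<longlongrightarrow> l) at_top"
    and pos: "\<And>v. AE \<omega> in M. cond_prob_given M (C t) (exceedance M (X t) v) \<omega> > 0"
    and coeff: "is_tail_coeff M F X Y C t \<Gamma>"
  shows "AE \<omega> in M. \<Gamma> \<omega> \<ge> l"
proof -
  have subC: "subalgebra M (C t)"
    using sub by (auto simp: subalgebra_def)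
  have XM [measurable]: "X t \<in> borel_measurable M"
    using measurable_from_subalg[OF sub(1) X] .
  have VM [measurable]: "V \<in> borel_measurable M"
    using measurable_from_subalg[OF subC V] .
  have psiI: "integrable M (\<lambda>\<omega>. \<psi> (X t \<omega>, V \<omega>))"
    using bdd by (intro integrable_const_bound[where B = c]) auto
  have ex: "exceedance M (X t) v \<in> sets G" for v
  proof -
    have "X t -` {v<..} \<inter> space G \<in> sets G"
      by (rule measurable_sets[OF X]) simp
    moreover have "X t -` {v<..} \<inter> space G = exceedance M (X t) v"
      using sub(1) by (auto simp: exceedance_def subalgebra_def)
    ultimately show ?thesis by simp
  qed
  have below: "AE \<omega> in M. \<Gamma> \<omega> \<ge> b" if b: "b < l" for b
  proof -
    obtain P :: "nat \<Rightarrow> 'b set" where P: "\<And>n. P n \<in> sets borel" "(\<Inter>n. P n) = {}"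
      "\<And>n. AE \<omega> in M. V \<omega> \<notin> P n \<longrightarrow> X t \<omega> > real n \<longrightarrow> \<psi> (X t \<omega>, V \<omega>) \<ge> b"
      by (rule tail_lower_bound[OF XM VM psi T lim b]) blast+
    define R where "R = cond_exp_exceed M (C t) (\<lambda>\<omega>'. F (Y (t+1) \<omega>')) (X t)"
    \<comment> \<open>Both indices stay fixed here, so that the null sets can be merged before n is
      chosen depending on \<omega>.\<close>
    have "AE \<omega> in M. V \<omega> \<notin> P n \<longrightarrow> m \<ge> n \<longrightarrow> R (real m) \<omega> \<ge> b" for n m
    proof (cases "m \<ge> n")
      case True
      define D where "D = {\<omega> \<in> space M. V \<omega> \<notin> P n}"
      have "V -` (- P n) \<inter> space (C t) \<in> sets (C t)"
        using P(1) by (intro measurable_sets[OF V]) auto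
      moreover have "V -` (- P n) \<inter> space (C t) = D"
        using subC by (auto simp: D_def subalgebra_def)
      ultimately have D: "D \<in> sets (C t)" by simp
      have "AE \<omega> in M. \<omega> \<in> D \<longrightarrow> \<omega> \<in> exceedance M (X t) (real m) \<longrightarrow> \<psi> (X t \<omega>, V \<omega>) \<ge> b"
        using P(3)[of n] by eventually_elim (use True in \<open>auto simp: D_def exceedance_def\<close>)
      from tail_cond_exp_ge[OF sub f cond psiI ex D this] pos[of "real m"] AE_space
      show ?thesis
        by eventually_elim (auto simp: R_def cond_exp_exceed_def D_def pos_le_divide_eq)
    qed simp
    then have "AE \<omega> in M. \<forall>n m. V \<omega> \<notin> P n \<longrightarrow> m \<ge> n \<longrightarrow> R (real m) \<omega> \<ge> b"
      unfolding AE_all_countable by blast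
    with tail_coeff_LIMSEQ[OF coeff] show ?thesis
    proof eventually_elim
      case (elim \<omega>)
      \<comment> \<open>The empty intersection supplies the path-dependent threshold: from this n
        on, all terms of the sequence are at least b.\<close>
      obtain n where "V \<omega> \<notin> P n" using P(2) by blast
      with elim show ?case
        by (intro LIMSEQ_le_const[of _ "\<Gamma> \<omega>" b]) (auto simp: R_def)
    qed
  qed
  have "AE \<omega> in M. \<forall>k::nat. \<Gamma> \<omega> \<ge> l - 1 / real (Suc k)"
    unfolding AE_all_countable by (intro allI below) simp
  then show ?thesis
  proof eventually_elim
    case (elim \<omega>)
    have "(\<lambda>k. l - 1 / real (Suc k)) \<longlonglongrightarrow> l - 0"
      by (intro tendsto_diff tendsto_const LIMSEQ_Suc[OF lim_1_over_n])
    then show ?case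
      using elim by (intro LIMSEQ_le_const2[of _ l]) auto
  qed
qed


section \<open>Structurally generated responses\<close>

text \<open>\<open>f\<close> sees \<open>G\<close> only through \<open>V\<close>, so freezing yields
  a conditional probability \<open>p\<close> given \<open>G\<close> that is already measurable for
  \<open>K\<close>. Joint events with any set of \<open>G\<close> then factorise given
  \<open>K\<close>.\<close>

lemma (in prob_space) cond_indep_if_noise_driven:
  fixes f :: "'u \<times> 'e \<Rightarrow> real"
  assumes sub: "subalgebra M G" "subalgebra G K" "subalgebra G H"
    and eps: "\<epsilon> \<in> measurable M N"
    and indep: "indep_set (sets (vimage_algebra (space M) \<epsilon> N)) (sets G)"
    and V: "V \<in> measurable K S"
    and f [measurable]: "f \<in> borel_measurable (S \<Otimes>\<^sub>M N)"
    and Y [measurable]: "Y t \<in> borel_measurable M"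
    and Yf: "AE \<omega> in M. Y t \<omega> = f (V \<omega>, \<epsilon> \<omega>)"
  shows "cond_indep M (gen_sigma M Y {t}) H K"
  unfolding cond_indep_def
proof (intro ballI)
  fix A B assume "A \<in> sets (gen_sigma M Y {t})" and B: "B \<in> sets H"
  then obtain Q where A: "A = Y t -` Q \<inter> space M" and Q [measurable]: "Q \<in> sets borel"
    by (auto simp: sets_gen_sigma_singleton)
  have subK: "subalgebra M K"
    using sub by (auto simp: subalgebra_def)
  interpret G: sigma_finite_subalgebra M G
    by (rule sigma_finite_subalgebraI) fact
  interpret K: sigma_finite_subalgebra M K
    by (rule sigma_finite_subalgebraI) fact
  have BG: "B \<in> sets G"
    using B sub by (auto simp: subalgebra_def)
  then have [measurable]: "B \<in> sets M"
    using sub by (auto simp: subalgebra_def)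
  have [measurable]: "A \<in> sets M"
    unfolding A using Y Q by (rule measurable_sets)
  have VG: "V \<in> measurable G S"
    using measurable_from_subalg[OF sub(2) V] .
  have [measurable]: "V \<in> measurable M S" "\<epsilon> \<in> measurable M N"
    using measurable_from_subalg[OF subK V] eps by auto
  define g where "g = (\<lambda>q. indicator Q (f q) :: real)"
  have g [measurable]: "g \<in> borel_measurable (S \<Otimes>\<^sub>M N)"
    unfolding g_def by measurable
  interpret L: prob_space "distr M N \<epsilon>"
    by (rule prob_space_distr) fact
  define p where "p = (\<lambda>\<omega>. \<integral>e. g (V \<omega>, e) \<partial>distr M N \<epsilon>)"
  have "(\<lambda>u. \<integral>e. g (u, e) \<partial>distr M N \<epsilon>) \<in> borel_measurable S"
    by measurable
  from measurable_compose[OF V this] have pK: "p \<in> borel_measurable K"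
    by (simp add: p_def)
  then have pM [measurable]: "p \<in> borel_measurable M"
    using measurable_from_subalg[OF subK] by blast
  have "\<bar>p \<omega>\<bar> \<le> 1" for \<omega>
    unfolding p_def by (rule L.abs_expectation_le) (simp add: g_def indicator_def)
  then have pI: "integrable M p"
    by (intro integrable_const_bound[where B = 1]) auto
  have Ag: "AE \<omega> in M. indicator A \<omega> = g (V \<omega>, \<epsilon> \<omega>)"
    using Yf AE_space by eventually_elim (auto simp: A g_def indicator_def)
  have iI: "integrable M (indicator E :: 'a \<Rightarrow> real)" if "E \<in> sets M" for E
    using that by (intro integrable_real_indicator) (auto simp: emeasure_eq_measure)
  have "AE \<omega> in M. real_cond_exp M G (indicator A) \<omega> = real_cond_exp M G (\<lambda>\<omega>. g (V \<omega>, \<epsilon> \<omega>)) \<omega>"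
    using Ag by (intro G.real_cond_exp_cong) auto
  moreover have "AE \<omega> in M. real_cond_exp M G (\<lambda>\<omega>. g (V \<omega>, \<epsilon> \<omega>)) \<omega> = p \<omega>"
    unfolding p_def by (rule real_cond_exp_freeze[OF sub(1) eps indep VG g, of 1])
      (simp add: g_def indicator_def)
  ultimately have pA: "AE \<omega> in M. real_cond_exp M G (indicator A) \<omega> = p \<omega>"
    by eventually_elim simp
  have "AE \<omega> in M. cond_prob_given M K (A \<inter> B') \<omega> = p \<omega> * cond_prob_given M K B' \<omega>"
    if B': "B' \<in> sets G" for B'
  proof -
    have [measurable]: "B' \<in> sets M"
      using B' sub by (auto simp: subalgebra_def)
    have iB: "(indicator B' :: 'a \<Rightarrow> real) \<in> borel_measurable G"
      using B' by simp
    have eq: "indicator (A \<inter> B') = (\<lambda>\<omega>. indicator B' \<omega> * indicator A \<omega> :: real)"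
      by (auto simp: indicator_def)
    have "AE \<omega> in M. real_cond_exp M G (\<lambda>\<omega>. indicator B' \<omega> * indicator A \<omega>) \<omega>
        = indicator B' \<omega> * real_cond_exp M G (indicator A) \<omega>"
      by (rule G.real_cond_exp_mult[OF iB]) (auto simp: eq[symmetric] intro: iI)
    with pA have "AE \<omega> in M. real_cond_exp M G (indicator (A \<inter> B')) \<omega> = p \<omega> * indicator B' \<omega>"
      unfolding eq by eventually_elim simp
    then have "AE \<omega> in M. real_cond_exp M K (indicator (A \<inter> B')) \<omega>
        = real_cond_exp M K (\<lambda>\<omega>. p \<omega> * indicator B' \<omega>) \<omega>"
      by (intro cond_exp_AE_eqI[OF sub(1,2)] iI) auto
    moreover have "AE \<omega> in M. real_cond_exp M K (\<lambda>\<omega>. p \<omega> * indicator B' \<omega>) \<omega>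
        = p \<omega> * real_cond_exp M K (indicator B') \<omega>"
      by (rule K.real_cond_exp_mult[OF pK]) (auto intro: integrable_real_mult_indicator pI)
    ultimately show ?thesis
      unfolding cond_prob_given_def by eventually_elim simp
  qed
  note pAB = this
  \<comment> \<open>The whole space is a particular test set; it identifies \<open>p\<close> as the
    conditional probability of \<open>A\<close> given \<open>K\<close>.\<close>
  have "AE \<omega> in M. cond_prob_given M K (A \<inter> space M) \<omega> = p \<omega> * cond_prob_given M K (space M) \<omega>"
    using pAB[of "space M"] sub(1) sets.top[of G] by (simp add: subalgebra_def)
  moreover have "AE \<omega> in M. cond_prob_given M K (space M) \<omega> = 1"
  proof -
    have spK: "space M \<in> sets K"
      using sets.top[of K] subK unfolding subalgebra_def by metis
    have "AE \<omega> in M. real_cond_exp M K (indicator (space M)) \<omega> = indicator (space M) \<omega>"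
      by (intro K.real_cond_exp_F_meas iI borel_measurable_indicator spK sets.top)
    with AE_space show ?thesis
      unfolding cond_prob_given_def by eventually_elim simp
  qed
  moreover have "A \<inter> space M = A"
    by (auto simp: A)
  ultimately have "AE \<omega> in M. cond_prob_given M K A \<omega> = p \<omega>"
    by (auto elim: eventually_elim2)
  with pAB[OF BG] show "AE \<omega> in M. cond_prob_given M K (A \<inter> B) \<omega>
      = cond_prob_given M K A \<omega> * cond_prob_given M K B \<omega>"
    by eventually_elim simp
qed

text \<open>Freezing turns F of the response into the average \<psi> of F (h (x, u, e)) over the
  noise law. Divergence of \<open>h\<close> sends the integrand to \<open>l\<close>, and dominated
  convergence does the same for \<psi>.\<close>

lemma (in prob_space) tail_coeff_ge_if_response_diverges:
  fixes F :: "real \<Rightarrow> real" and A :: "('b::{second_countable_topology, complete_space} \<times> 'e) set"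
    and h :: "real \<times> 'b \<times> 'e \<Rightarrow> real"
  assumes sub: "subalgebra M G" "subalgebra G (C t)"
    and X: "X t \<in> borel_measurable G" and V: "V \<in> borel_measurable (C t)"
    and Y [measurable]: "Y (t+1) \<in> borel_measurable M"
    and eps: "\<epsilon> \<in> measurable M N"
    and indep: "indep_set (sets (vimage_algebra (space M) \<epsilon> N)) (sets G)"
    and F [measurable]: "F \<in> borel_measurable borel" and bdd: "\<And>x. \<bar>F x\<bar> \<le> c"
    and Flim: "(F \<longlongrightarrow> l) at_top"
    and h [measurable]: "h \<in> borel_measurable (borel \<Otimes>\<^sub>M borel \<Otimes>\<^sub>M N)"
    and A [measurable]: "A \<in> sets (borel \<Otimes>\<^sub>M N)"
    and VA: "AE \<omega> in M. (V \<omega>, \<epsilon> \<omega>) \<in> A"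
    and Yh: "AE \<omega> in M. Y (t+1) \<omega> = h (X t \<omega>, V \<omega>, \<epsilon> \<omega>)"
    and lim: "\<And>u e. (u, e) \<in> A \<Longrightarrow> filterlim (\<lambda>x. h (x, u, e)) at_top at_top"
    and pos: "\<And>v. AE \<omega> in M. cond_prob_given M (C t) (exceedance M (X t) v) \<omega> > 0"
    and coeff: "is_tail_coeff M F X Y C t \<Gamma>"
  shows "AE \<omega> in M. \<Gamma> \<omega> \<ge> l"
proof -
  have subC: "subalgebra M (C t)"
    using sub by (auto simp: subalgebra_def)
  interpret G: sigma_finite_subalgebra M G
    by (rule sigma_finite_subalgebraI) fact
  have VG: "V \<in> borel_measurable G"
    using measurable_from_subalg[OF sub(2) V] .
  have [measurable]: "X t \<in> borel_measurable M" "V \<in> borel_measurable M" "\<epsilon> \<in> measurable M N"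
    using measurable_from_subalg[OF sub(1) X] measurable_from_subalg[OF subC V] eps by auto
  define L where "L = distr M N \<epsilon>"
  interpret L: prob_space L
    unfolding L_def by (rule prob_space_distr) fact
  have setsL [measurable_cong]: "sets L = sets N" by (simp add: L_def)
  define U where "U = (\<lambda>\<omega>. (X t \<omega>, V \<omega>))"
  have UG: "U \<in> measurable G (borel \<Otimes>\<^sub>M borel)"
    unfolding U_def using X VG by measurable
  define f where "f = (\<lambda>(q, e). F (h (fst q, snd q, e)))"
  have f [measurable]: "f \<in> borel_measurable ((borel \<Otimes>\<^sub>M borel) \<Otimes>\<^sub>M N)"
    unfolding f_def by measurable
  define \<psi> where "\<psi> = (\<lambda>q. \<integral>e. f (q, e) \<partial>L)"
  have "\<psi> \<in> borel_measurable (borel \<Otimes>\<^sub>M borel)"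
    unfolding \<psi>_def by measurable
  then have psi: "\<psi> \<in> borel_measurable borel"
    by (simp add: borel_prod)
  have hL: "(\<lambda>e. h (x, u, e)) \<in> borel_measurable L" for x u
    by measurable
  have psi_bdd: "\<bar>\<psi> q\<bar> \<le> c" for q
    unfolding \<psi>_def f_def by (rule L.abs_expectation_le) (simp add: bdd)
  have FYI: "integrable M (\<lambda>\<omega>. F (Y (t+1) \<omega>))"
    using bdd by (intro integrable_const_bound[where B = c]) auto
  have "AE \<omega> in M. real_cond_exp M G (\<lambda>\<omega>. F (Y (t+1) \<omega>)) \<omega>
      = real_cond_exp M G (\<lambda>\<omega>. f (U \<omega>, \<epsilon> \<omega>)) \<omega>"
    using Yh by (intro G.real_cond_exp_cong) (auto simp: f_def U_def)
  moreover have "AE \<omega> in M. real_cond_exp M G (\<lambda>\<omega>. f (U \<omega>, \<epsilon> \<omega>)) \<omega> = \<psi> (U \<omega>)"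
    unfolding \<psi>_def L_def by (rule real_cond_exp_freeze[OF sub(1) eps indep UG f, of c])
      (simp add: f_def bdd split: prod.splits)
  ultimately have cond: "AE \<omega> in M. real_cond_exp M G (\<lambda>\<omega>. F (Y (t+1) \<omega>)) \<omega> = \<psi> (X t \<omega>, V \<omega>)"
    by eventually_elim (simp add: U_def)
  \<comment> \<open>Divergence is assumed only on \<open>A\<close>. The limit of \<psi> is therefore
    sought at those u whose slice of \<open>A\<close> has full noise measure.\<close>
  define T where "T = {u. (\<integral>e. indicator A (u, e) \<partial>L) = (1::real)}"
  have "(\<lambda>u. \<integral>e. indicator A (u, e) \<partial>L :: real) \<in> borel_measurable borel"
    by measurable
  then have T: "T \<in> sets borel"
    unfolding T_def by simp
  have VT: "AE \<omega> in M. V \<omega> \<in> T"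
  proof -
    \<comment> \<open>Freezing the indicator of \<open>A\<close> exhibits the slice measure at
      \<open>V\<close> as the conditional expectation of a variable that is almost surely 1.\<close>
    have "AE \<omega> in M. real_cond_exp M G (\<lambda>\<omega>. indicator A (V \<omega>, \<epsilon> \<omega>)) \<omega>
        = (\<integral>e. indicator A (V \<omega>, e) \<partial>L)"
      unfolding L_def by (rule real_cond_exp_freeze[OF sub(1) eps indep VG, of _ 1])
        (auto simp: indicator_def)
    moreover have "AE \<omega> in M. real_cond_exp M G (\<lambda>\<omega>. indicator A (V \<omega>, \<epsilon> \<omega>)) \<omega>
        = real_cond_exp M G (\<lambda>\<omega>. 1) \<omega>"
      using VA by (intro G.real_cond_exp_cong) auto
    moreover have "AE \<omega> in M. real_cond_exp M G (\<lambda>\<omega>. 1) \<omega> = 1"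
      by (rule G.real_cond_exp_F_meas) auto
    ultimately show ?thesis
      by eventually_elim (simp add: T_def)
  qed
  have "((\<lambda>x. \<psi> (x, u)) \<longlongrightarrow> l) at_top" if u: "u \<in> T" for u
  proof -
    have Au: "{e \<in> space L. (u, e) \<in> A} \<in> sets L"
      by measurable
    have "(\<integral>e. indicator A (u, e) \<partial>L) = (\<integral>e. indicator {e \<in> space L. (u, e) \<in> A} e \<partial>L :: real)"
      by (intro Bochner_Integration.integral_cong) (auto simp: indicator_def)
    then have "L.prob {e \<in> space L. (u, e) \<in> A} = 1"
      using u Au by (simp add: T_def)
    then have "AE e in L. (u, e) \<in> A"
      using Au by (subst (asm) L.prob_Collect_eq_1) auto
    then have "AE e in L. ((\<lambda>x. F (h (x, u, e))) \<longlongrightarrow> l) at_top"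
      by eventually_elim (intro filterlim_compose[OF Flim] lim)
    then have "((\<lambda>x. \<integral>e. F (h (x, u, e)) \<partial>L) \<longlongrightarrow> (\<integral>e. l \<partial>L)) at_top"
      using hL bdd by (intro integral_dominated_convergence_at_top[where w = "\<lambda>_. c"]) auto
    then show ?thesis
      by (simp add: \<psi>_def f_def L.prob_space)
  qed
  then show ?thesis
    by (rule tail_coeff_ge[where G = G and \<psi> = \<psi> and T = T and c = c,
          OF sub X V FYI psi psi_bdd cond T VT _ pos coeff])
qed


theorem proposition2:
  fixes M :: "'a measure"
    and X Y :: "int \<Rightarrow> 'a \<Rightarrow> real"
    and Z :: "int \<Rightarrow> 'a \<Rightarrow> 'z::euclidean_space"
    and \<mu> :: "real measure" and F :: "real \<Rightarrow> real"
    and I C :: "int \<Rightarrow> 'a measure" and Adm :: "(int \<Rightarrow> 'a measure) set"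
    and N :: "'e measure" and \<epsilon> :: "int \<Rightarrow> 'a \<Rightarrow> 'e"
    and h :: "real \<Rightarrow> real \<Rightarrow> 'z \<Rightarrow> 'e \<Rightarrow> real"
    and A :: "(real \<times> 'z \<times> 'e) set"
  assumes "prob_space M"
    and "\<And>t. X t \<in> borel_measurable M"
    and "\<And>t. Y t \<in> borel_measurable M"
    and "\<And>t. Z t \<in> borel_measurable M"
    and "one_markov M (joint X Y Z)"
    and "\<And>t. supported_near_infinity M (X t)"
    and "\<And>t. supported_near_infinity M (Y t)"
    and "real_distribution \<mu>" and "F = cdf \<mu>" and "\<And>x. F x < 1"
    and "C = info_without_X M Y Z"
    and "tail_coeffs_well_defined M F X Y C"
    and "information_flow M (joint X Y Z) I"
    and "causally_sufficient M F X Y I Adm C"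
  shows "(tail_causes M F X Y C \<longrightarrow> granger_causes M X Y C) \<and>
    (structurally_generated M X Y Z N \<epsilon> h A \<longrightarrow>
       ((\<forall>(y, z, e)\<in>A. filterlim (\<lambda>x. h x y z e) at_top at_top) \<or>
        (\<forall>(y, z, e)\<in>A. \<forall>x x'. h x y z e = h x' y z e)) \<longrightarrow>
       granger_causes M X Y C \<longrightarrow> tail_causes M F X Y C)"
proof -

  \<comment> \<open>Measurability and information inclusions for both implications\<close>
  interpret prob_space M by fact
  note meas [measurable] = assms(2-4)
  interpret \<mu>: real_distribution \<mu> by fact
  note C = assms(11)
  have F: "F \<in> borel_measurable borel"
    unfolding \<open>F = cdf \<mu>\<close> by (intro borel_measurable_mono monoI \<mu>.cdf_nondecreasing)
  have F_bdd: "\<bar>F x\<bar> \<le> 1" for x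
    unfolding \<open>F = cdf \<mu>\<close> using \<mu>.cdf_nonneg \<mu>.cdf_bounded_prob by simp
  have F_lim: "(F \<longlongrightarrow> 1) at_top"
    unfolding \<open>F = cdf \<mu>\<close> by (rule \<mu>.cdf_lim_at_top_prob)
  \<comment> \<open>The strict past, as in the noise assumption. Hence \<open>G (t+1)\<close> is the
    full information up to time t, including \<open>X t\<close>, and is independent of the noise at
    time t+1.\<close>
  define G where "G = (\<lambda>t. gen_sigma M (joint X Y Z) {..<t})"
  have joint [measurable]: "joint X Y Z s \<in> borel_measurable M" for s
    unfolding joint_def[abs_def] by measurable
  have subG: "subalgebra M (G t)" for t
    unfolding G_def by (rule subalgebra_gen_sigma) auto
  have coord: "X s \<in> borel_measurable (G t)" "(\<lambda>\<omega>. (Y s \<omega>, Z s \<omega>)) \<in> borel_measurable (G t)"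
    if "s < t" for s t
  proof -
    have J: "joint X Y Z s \<in> borel_measurable (G t)"
      unfolding G_def by (rule measurable_gen_sigma) (use that in simp)
    have "fst \<in> borel_measurable (borel :: (real \<times> real \<times> 'z) measure)"
      "snd \<in> borel_measurable (borel :: (real \<times> real \<times> 'z) measure)"
      by (auto intro!: borel_measurable_continuous_onI continuous_intros)
    from this[THEN measurable_compose[OF J]]
    show "X s \<in> borel_measurable (G t)" "(\<lambda>\<omega>. (Y s \<omega>, Z s \<omega>)) \<in> borel_measurable (G t)"
      by (simp_all add: joint_def)
  qed
  have spG: "space (G t) = space M" for t
    by (simp add: G_def)
  have subC: "subalgebra (G (t+1)) (C t)" for t
    unfolding C info_without_X_def by (intro subalgebra_gen_sigma spG coord) simp
  have subMC: "subalgebra M (C t)" for t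
    using subG[of "t+1"] subC[of t] by (auto simp: subalgebra_def)
  have subX: "subalgebra (G (t+1)) (gen_sigma M X {..t})" for t
    by (intro subalgebra_gen_sigma spG coord) simp
  have VC: "(\<lambda>\<omega>. (Y t \<omega>, Z t \<omega>)) \<in> borel_measurable (C t)" for t
    unfolding C info_without_X_def
    using measurable_gen_sigma[of t "{..t}" "\<lambda>s \<omega>. (Y s \<omega>, Z s \<omega>)"] by simp
  have pos: "AE \<omega> in M. cond_prob_given M (C t) (exceedance M (X t) v) \<omega> > 0" for t v
    using assms(12) unfolding tail_coeffs_well_defined_def by blast

  \<comment> \<open>Tail causality implies Granger causality\<close>
  have i: "granger_causes M X Y C" if tc: "tail_causes M F X Y C"
  proof (rule ccontr)
    assume "\<not> granger_causes M X Y C"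
    then have ci: "cond_indep M (gen_sigma M Y {t+1}) (gen_sigma M X {..t}) (C t)" for t
      by (auto simp: granger_causes_def)
    obtain t \<Gamma> where coeff: "is_tail_coeff M F X Y C t \<Gamma>"
      and "\<not> (AE \<omega> in M. \<Gamma> \<omega> = baseline_coeff M F Y C t \<omega>)"
      using tc by (auto simp: tail_causes_def)
    then show False
      using tail_coeff_eq_baseline[where X = X and Y = Y and C = C and t = t,
          OF meas(1,2) F F_bdd subMC ci pos coeff] by blast
  qed

  \<comment> \<open>The converse under structural generation\<close>
  have ii: "tail_causes M F X Y C"
    if sg: "structurally_generated M X Y Z N \<epsilon> h A"
      and h_cases: "(\<forall>(y, z, e)\<in>A. filterlim (\<lambda>x. h x y z e) at_top at_top) \<or>
        (\<forall>(y, z, e)\<in>A. \<forall>x x'. h x y z e = h x' y z e)"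
      and gc: "granger_causes M X Y C"
  proof -
    have h [measurable]:
      "(\<lambda>(x, y, z, e). h x y z e) \<in> borel_measurable (borel \<Otimes>\<^sub>M borel \<Otimes>\<^sub>M borel \<Otimes>\<^sub>M N)"
      and A [measurable]: "A \<in> sets (borel \<Otimes>\<^sub>M borel \<Otimes>\<^sub>M N)"
      using sg by (auto simp: structurally_generated_def)
    have noise: "\<epsilon> t \<in> measurable M N \<and>
        indep_set (sets (vimage_algebra (space M) (\<epsilon> t) N)) (sets (G t)) \<and>
        (AE \<omega> in M. (Y (t-1) \<omega>, Z (t-1) \<omega>, \<epsilon> t \<omega>) \<in> A) \<and>
        (AE \<omega> in M. Y t \<omega> = h (X (t-1) \<omega>) (Y (t-1) \<omega>) (Z (t-1) \<omega>) (\<epsilon> t \<omega>))" for t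
      using sg unfolding structurally_generated_def G_def by blast
    have eps: "\<epsilon> (t+1) \<in> measurable M N"
      and indep: "indep_set (sets (vimage_algebra (space M) (\<epsilon> (t+1)) N)) (sets (G (t+1)))"
      and VA: "AE \<omega> in M. (Y t \<omega>, Z t \<omega>, \<epsilon> (t+1) \<omega>) \<in> A"
      and Yh: "AE \<omega> in M. Y (t+1) \<omega> = h (X t \<omega>) (Y t \<omega>) (Z t \<omega>) (\<epsilon> (t+1) \<omega>)" for t
      using noise[of "t+1"] by simp_all
    \<comment> \<open>Regrouping makes the pair (y, z) a single point u, matching the lemmas above,
      where \<open>V\<close> is the pair of \<open>Y t\<close> and \<open>Z t\<close>.\<close>
    define h' where "h' = (\<lambda>q. h (fst q) (fst (fst (snd q))) (snd (fst (snd q))) (snd (snd q)))"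
    have "(\<lambda>q. (fst q, fst (fst (snd q)), snd (fst (snd q)), snd (snd q)))
        \<in> measurable (borel \<Otimes>\<^sub>M (borel \<Otimes>\<^sub>M borel) \<Otimes>\<^sub>M N) (borel \<Otimes>\<^sub>M borel \<Otimes>\<^sub>M borel \<Otimes>\<^sub>M N)"
      by measurable
    from measurable_compose[OF this h]
    have h': "h' \<in> borel_measurable (borel \<Otimes>\<^sub>M (borel :: (real \<times> 'z) measure) \<Otimes>\<^sub>M N)"
      by (simp add: h'_def borel_prod)
    have constant_case: False if const: "\<forall>(y, z, e)\<in>A. \<forall>x x'. h x y z e = h x' y z e"
    proof -
      \<comment> \<open>On \<open>A\<close> the value of \<open>h\<close> does not depend on x, so x
        may be frozen at 0; the response is then a function of \<open>V\<close> and the noise, which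
        contradicts Granger causality.\<close>
      have f: "(\<lambda>(u, e). h' (0, u, e)) \<in> borel_measurable ((borel :: (real \<times> 'z) measure) \<Otimes>\<^sub>M N)"
        using h' by measurable
      have "AE \<omega> in M. Y (t+1) \<omega> = (\<lambda>(u, e). h' (0, u, e)) ((Y t \<omega>, Z t \<omega>), \<epsilon> (t+1) \<omega>)" for t
        using Yh[of t] VA[of t] by eventually_elim (use const in \<open>fastforce simp: h'_def\<close>)
      then have "cond_indep M (gen_sigma M Y {t+1}) (gen_sigma M X {..t}) (C t)" for t
        by (rule cond_indep_if_noise_driven[where Y = Y and t = "t+1", OF subG subC subX eps indep VC f meas(2)])
      with gc show False
        by (auto simp: granger_causes_def)
    qed
    have diverging_case: "tail_causes M F X Y C"
      if div: "\<forall>(y, z, e)\<in>A. filterlim (\<lambda>x. h x y z e) at_top at_top"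
    proof -
      \<comment> \<open>A single time suffices as a witness, and the coefficients are well defined
        at every time; 0 is an arbitrary choice.\<close>
      obtain \<Gamma> where coeff: "is_tail_coeff M F X Y C 0 \<Gamma>"
        using assms(12) unfolding tail_coeffs_well_defined_def by blast
      define \<pi> where "\<pi> = (\<lambda>q :: (real \<times> 'z) \<times> 'e. (fst (fst q), snd (fst q), snd q))"
      define A' where "A' = \<pi> -` A \<inter> space (borel \<Otimes>\<^sub>M N)"
      have "\<pi> \<in> measurable ((borel \<Otimes>\<^sub>M borel) \<Otimes>\<^sub>M N) (borel \<Otimes>\<^sub>M borel \<Otimes>\<^sub>M N)"
        unfolding \<pi>_def by measurable
      then have "\<pi> \<in> measurable (borel \<Otimes>\<^sub>M N) (borel \<Otimes>\<^sub>M borel \<Otimes>\<^sub>M N)"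
        by (simp add: borel_prod)
      then have A': "A' \<in> sets (borel \<Otimes>\<^sub>M N)"
        unfolding A'_def using A by (rule measurable_sets)
      have VA': "AE \<omega> in M. ((Y 0 \<omega>, Z 0 \<omega>), \<epsilon> (0+1) \<omega>) \<in> A'"
        using VA[of 0] AE_space
        by eventually_elim (use measurable_space[OF eps[of 0]] in \<open>auto simp: A'_def \<pi>_def space_pair_measure\<close>)
      have XG: "X 0 \<in> borel_measurable (G (0+1))"
        by (rule coord) simp
      have Yh': "AE \<omega> in M. Y (0+1) \<omega> = h' (X 0 \<omega>, (Y 0 \<omega>, Z 0 \<omega>), \<epsilon> (0+1) \<omega>)"
        using Yh[of 0] by (simp add: h'_def)
      have "filterlim (\<lambda>x. h' (x, u, e)) at_top at_top" if "(u, e) \<in> A'" for u e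
        using div that by (cases u) (auto simp: h'_def A'_def \<pi>_def dest!: bspec)
      then have ge: "AE \<omega> in M. \<Gamma> \<omega> \<ge> 1"
        by (rule tail_coeff_ge_if_response_diverges[where X = X and Y = Y and C = C and t = 0,
            OF subG subC XG VC meas(2) eps indep F F_bdd F_lim h' A' VA' Yh' _ pos coeff])
      interpret C0: sigma_finite_subalgebra M "C 0"
        by (rule sigma_finite_subalgebraI[OF subMC])
      have "integrable M (\<lambda>\<omega>. F (Y (0+1) \<omega>))"
        using F F_bdd by (intro integrable_const_bound[where B = 1]) auto
      \<comment> \<open>The pointwise strict inequality F < 1 survives conditioning, which separates
        the baseline from the coefficient.\<close>
      then have "AE \<omega> in M. baseline_coeff M F Y C 0 \<omega> < 1"
        unfolding baseline_coeff_def using assms(10) by (intro C0.real_cond_exp_less_c) auto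
      with ge have ne: "AE \<omega> in M. \<Gamma> \<omega> \<noteq> baseline_coeff M F Y C 0 \<omega>"
        by eventually_elim simp
      have "\<not> (AE \<omega> in M. \<Gamma> \<omega> = baseline_coeff M F Y C 0 \<omega>)"
      proof
        assume "AE \<omega> in M. \<Gamma> \<omega> = baseline_coeff M F Y C 0 \<omega>"
        with ne have "AE \<omega> in M. False" by eventually_elim simp
        then show False by simp
      qed
      with coeff show ?thesis
        unfolding tail_causes_def by blast
    qed
    from h_cases constant_case diverging_case show ?thesis by blast
  qed
  from i ii show ?thesis by blast
qed

end
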